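(* For every $n\in\mathbb{Z}$, the set $\{n,n+1,\ldots,n+35\}$ of $36$ consecutive integers reduces to zero.
   Context: For integers $a,b$, define $\mathcal{F}(a,b)=|a^{2}-b^{2}|$. A reduction step on a finite multiset $\mathcal{A}$ of integers removes two entries $a,b$ of $\mathcal{A}$ (two distinct occurrences, counted with multiplicity) and inserts $\mathcal{F}(a,b)$; thus each step decreases the size of the multiset by one. A finite (nonempty) multiset $\mathcal{A}$ of integers is said to reduce to zero if there is some sequence of reduction steps, starting from $\mathcal{A}$ and continuing until a single entry remains, for which that final entry is $0$. A finite set is regarded as a multiset in which every element has multiplicity one. *)

theory Defs
  imports Main "HOL-Library.Multiset"
begin

definition sq_diff :: "int \<Rightarrow> int \<Rightarrow> int" where
  "sq_diff a b = \<bar>a\<^sup>2 - b\<^sup>2\<bar>"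

text \<open>The removed entries are two distinct occurrences, but \<open>a = b\<close> is allowed when that value
  has multiplicity at least two.\<close>

inductive reduction_step :: "int multiset \<Rightarrow> int multiset \<Rightarrow> bool" where
  "reduction_step (B + {#a, b#}) (B + {#sq_diff a b#})"

definition reduces_to_zero :: "int multiset \<Rightarrow> bool" where
  "reduces_to_zero A \<longleftrightarrow> reduction_step\<^sup>*\<^sup>* A {#0#}"

end

theory Submission
  imports Defs
begin

text \<open>
  The union of two multisets that reduce to zero reduces to zero, because the two final zeros
  combine to \<open>sq_diff 0 0 = 0\<close>. So it is enough to partition the 36 integers into blocks that
  reduce to zero for every \<open>n\<close>. The partition has five blocks, with offsets from \<open>n\<close>
  \<^item> \<open>{2, 9, 10, 14, 15, 22}\<close> and its translate \<open>{13, 20, 21, 25, 26, 33}\<close> by 11,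
  \<^item> \<open>{0, 1, 7, 11, 24, 28, 34, 35}\<close>, \<open>{3, 4, 12, 16, 19, 23, 31, 32}\<close> and
    \<open>{5, 6, 8, 17, 18, 27, 29, 30}\<close>.

  Each block splits into two halves that reduce to the same number, hence to zero together.
  The value of \<open>a\<^sup>2 - b\<^sup>2\<close> is linear in \<open>n\<close> when \<open>a - n\<close> and \<open>b - n\<close> are constants, and a second
  step squares it, which removes the absolute value. After the second step a half has therefore
  the value \<open>\<bar>p\<bar>\<close> for a polynomial \<open>p\<close> in \<open>n\<close> of degree at most 2, irrespective of signs, and
  the offsets are chosen so that the two halves of a block have the same \<open>p\<close>. What is left for
  each block is one polynomial identity.

  All five blocks are symmetric under a reflection of the integers about a centre. If the two
  halves of a block are mirror images of each other, then their polynomials in the distance from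
  the centre differ only in the sign of the linear term, so that a half with an even polynomial
  suffices; three of the blocks are of this kind. In the other two, the halves agree because of a
  numerical coincidence between the differences of the paired integers.
\<close>

section \<open>Combining reductions\<close>

lemma reduction_step_add:
  assumes "reduction_step A B"
  shows "reduction_step (A + C) (B + C)"
  using assms
proof cases
  case (1 D a b)
  then show ?thesis
    using reduction_step.intros[of "D + C" a b] by (simp add: ac_simps)
qed

lemma reductions_add:
  assumes "reduction_step\<^sup>*\<^sup>* A B"
  shows "reduction_step\<^sup>*\<^sup>* (A + C) (B + C)"
  using assms
  by (induction) (auto intro: reduction_step_add rtranclp.rtrancl_into_rtrancl)

lemma reductions_combine:
  assumes "reduction_step\<^sup>*\<^sup>* A {#v#}" and "reduction_step\<^sup>*\<^sup>* B {#w#}"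
  shows "reduction_step\<^sup>*\<^sup>* (A + B) {#sq_diff v w#}"
proof -
  have "reduction_step\<^sup>*\<^sup>* (A + B) ({#v#} + B)"
    by (rule reductions_add[OF assms(1)])
  also have "reduction_step\<^sup>*\<^sup>* \<dots> ({#v#} + {#w#})"
    using reductions_add[OF assms(2), of "{#v#}"] by (simp add: add.commute)
  also have "reduction_step \<dots> {#sq_diff v w#}"
    using reduction_step.intros[of "{#}" v w] by (simp add: add_mset_commute)
  finally show ?thesis .
qed

lemma reduces_to_zero_add:
  assumes "reduces_to_zero A" and "reduces_to_zero B"
  shows "reduces_to_zero (A + B)"
  using reductions_combine[of A 0 B 0] assms by (simp add: reduces_to_zero_def sq_diff_def)

lemma reduces_to_zero_equal_halves:
  assumes "reduction_step\<^sup>*\<^sup>* A {#v#}" and "reduction_step\<^sup>*\<^sup>* B {#v#}"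
  shows "reduces_to_zero (A + B)"
  using reductions_combine[OF assms] by (simp add: reduces_to_zero_def sq_diff_def)

lemma reductions_pair: "reduction_step\<^sup>*\<^sup>* {#a, b#} {#sq_diff a b#}"
  using reductions_combine[of "{#a#}" a "{#b#}" b] by (simp add: add_mset_commute)

text \<open>The inner absolute values disappear under the squares of the outer step, so that values of
  two-step reductions can be compared by polynomial arithmetic without any case distinction.\<close>

lemma reductions_triple:
  "reduction_step\<^sup>*\<^sup>* {#a, b, c#} {#\<bar>(a\<^sup>2 - b\<^sup>2)\<^sup>2 - c\<^sup>2\<bar>#}"
  using reductions_combine[OF reductions_pair[of a b], of "{#c#}" c]
  by (simp add: sq_diff_def add_mset_commute)

lemma reductions_two_pairs:
  "reduction_step\<^sup>*\<^sup>* {#a, b, c, d#} {#\<bar>(a\<^sup>2 - b\<^sup>2)\<^sup>2 - (c\<^sup>2 - d\<^sup>2)\<^sup>2\<bar>#}"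
  using reductions_combine[OF reductions_pair[of a b] reductions_pair[of c d]]
  by (simp add: sq_diff_def add_mset_commute)

lemma reduces_to_zero_two_triples:
  assumes "(a\<^sup>2 - b\<^sup>2)\<^sup>2 - c\<^sup>2 = (a'\<^sup>2 - b'\<^sup>2)\<^sup>2 - c'\<^sup>2"
  shows "reduces_to_zero {#a, b, c, a', b', c'#}"
  using reduces_to_zero_equal_halves[OF reductions_triple[of a b c], of "{#a', b', c'#}"]
    reductions_triple[of a' b' c'] assms
  by (simp add: add_mset_commute)

lemma reduces_to_zero_four_pairs:
  assumes "(a\<^sup>2 - b\<^sup>2)\<^sup>2 - (c\<^sup>2 - d\<^sup>2)\<^sup>2 = (a'\<^sup>2 - b'\<^sup>2)\<^sup>2 - (c'\<^sup>2 - d'\<^sup>2)\<^sup>2"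
  shows "reduces_to_zero {#a, b, c, d, a', b', c', d'#}"
  using reduces_to_zero_equal_halves[OF reductions_two_pairs[of a b c d], of "{#a', b', c', d'#}"]
    reductions_two_pairs[of a' b' c' d'] assms
  by (simp add: add_mset_commute)

section \<open>Blocks that reduce to zero\<close>

text \<open>The first triple has the polynomial \<open>(2 * x - 5)\<^sup>2 - (x - 10)\<^sup>2 = 3 * x\<^sup>2 - 75\<close>. It is even in
  \<open>x\<close>, so the mirror image under \<open>x \<mapsto> - x\<close>, which is the second triple up to signs, shares it.\<close>

lemma reduces_to_zero_mirrored_triples:
  "reduces_to_zero {#x - 3, x - 2, x - 10, x + 2, x + 3, x + 10#}"
  by (rule reduces_to_zero_two_triples) algebra

text \<open>With \<open>y = 2 * x + 25\<close>, the first two pairs give \<open>22 * (y - 3)\<close> and \<open>11 * (y - 12)\<close> up to sign,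
  so the first half has the polynomial \<open>11\<^sup>2 * (4 * (y - 3)\<^sup>2 - (y - 12)\<^sup>2) = 11\<^sup>2 * (3 * y\<^sup>2 - 108)\<close>,
  which is even in \<open>y\<close>. The other two pairs are the mirror images under \<open>y \<mapsto> - y\<close>.\<close>

lemma reduces_to_zero_mirrored_pairs:
  "reduces_to_zero {#x, x + 22, x + 1, x + 12, x + 3, x + 25, x + 13, x + 24#}"
  by (rule reduces_to_zero_four_pairs) algebra

text \<open>In each half the two pairs have the same difference and sums on either side of the centre
  \<open>y = 2 * x + 35\<close>. The halves give \<open>34\<^sup>2 * ((y - 1)\<^sup>2 - (y + 1)\<^sup>2)\<close> and
  \<open>17\<^sup>2 * ((y - 4)\<^sup>2 - (y + 4)\<^sup>2)\<close>, which agree because \<open>34\<^sup>2 * 1 = 17\<^sup>2 * 4\<close>.\<close>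

lemma reduces_to_zero_equal_difference_pairs:
  "reduces_to_zero {#x, x + 34, x + 1, x + 35, x + 7, x + 24, x + 11, x + 28#}"
  by (rule reduces_to_zero_four_pairs) algebra

text \<open>All four pairs have the same sum \<open>y = 2 * x + 29\<close>, so a pair with difference \<open>d\<close> gives
  \<open>d * y\<close> up to sign. The halves agree because \<open>29\<^sup>2 - 27\<^sup>2 = 112 = 11\<^sup>2 - 3\<^sup>2\<close>.\<close>

lemma reduces_to_zero_equal_sum_pairs:
  "reduces_to_zero {#x, x + 29, x + 1, x + 28, x + 9, x + 20, x + 13, x + 16#}"
  by (rule reduces_to_zero_four_pairs) algebra

section \<open>Partition of 36 consecutive integers\<close>

theorem theorem1p1:
  fixes n :: int
  shows "reduces_to_zero (mset_set {n..n+35})"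
proof -
  define offsets :: "int list" where "offsets =
    [9, 10, 2, 14, 15, 22] @ [20, 21, 13, 25, 26, 33] @ [5, 27, 6, 17, 8, 30, 18, 29] @
    [0, 34, 1, 35, 7, 24, 11, 28] @ [3, 32, 4, 31, 12, 23, 16, 19]"
  have "set offsets = set [0..35]"
    by (simp add: offsets_def upto_rec1 insert_commute)
  then have "(+) n ` set offsets = {n..n+35}"
    by simp
  moreover have "distinct offsets"
    by (simp add: offsets_def)
  ultimately have "mset_set {n..n+35} = image_mset ((+) n) (mset offsets)"
    by (metis image_mset_mset_set inj_on_add mset_set_set)
  also have "\<dots> =
      {#n + 9, n + 10, n + 2, n + 14, n + 15, n + 22#} +
      ({#n + 20, n + 21, n + 13, n + 25, n + 26, n + 33#} +
      ({#n + 5, n + 27, n + 6, n + 17, n + 8, n + 30, n + 18, n + 29#} +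
      ({#n, n + 34, n + 1, n + 35, n + 7, n + 24, n + 11, n + 28#} +
       {#n + 3, n + 32, n + 4, n + 31, n + 12, n + 23, n + 16, n + 19#})))"
    by (simp add: offsets_def)
  also have "reduces_to_zero \<dots>"
    using reduces_to_zero_mirrored_triples[of "n + 12"]
      reduces_to_zero_mirrored_triples[of "n + 23"]
      reduces_to_zero_mirrored_pairs[of "n + 5"]
      reduces_to_zero_equal_difference_pairs[of n]
      reduces_to_zero_equal_sum_pairs[of "n + 3"]
    by (intro reduces_to_zero_add) (simp_all add: add.commute)
  finally show ?thesis .
qed

end
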